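(* The sequent calculi $G(\mathbf{K4}_h)$, $G(\mathbf{KD4}_h)$ and $G(\mathbf{S4}_h)$ have the cut elimination property: every sequent provable in one of these systems has a proof in the same system that does not use the cut rule.
   Context: The language $\mathcal{L}_\infty$ consists of modal formulas built from propositional atoms, $\bot,\top$, the connectives $\neg,\wedge,\vee,\rightarrow$ and infinitely many unary modalities $\Box_n$ ($n\in\mathbb{N}$), with the restriction that $\Box_n A$ is a formula only if $n$ is strictly greater than the index of every box occurring in $A$. All formulas are in $\mathcal{L}_\infty$. Sequent calculi: sequents $\Gamma\Rightarrow\Delta$ with finite multisets. All three systems contain the axioms $A\Rightarrow A$ and $\bot\Rightarrow$, the structural rules of left/right weakening, left/right contraction and cut (from $\Gamma_0\Rightarrow\Delta_0,A$ and $\Gamma_1,A\Rightarrow\Delta_1$ infer $\Gamma_0,\Gamma_1\Rightarrow\Delta_0,\Delta_1$), and the usual classical (LK-style) left and right rules for $\wedge,\vee,\rightarrow,\neg$. Modal rules (in each, the side condition is $n_i<n$ for all $i\in I$): $\Box_{4_h}R$: from $\{\sigma_r\}_{r\in R},\{\gamma_i,\Box_{n_i}\gamma_i\}_{i\in I}\Rightarrow A$ infer $\{\Box_n\sigma_r\}_{r\in R},\{\Box_{n_i}\gamma_i\}_{i\in I}\Rightarrow\Box_nA$; $\Box_{D_h}R$: from $\{\sigma_r\}_{r\in R},\{\gamma_i,\Box_{n_i}\gamma_i\}_{i\in I}\Rightarrow$ infer $\{\Box_n\sigma_r\}_{r\in R},\{\Box_{n_i}\gamma_i\}_{i\in I}\Rightarrow$;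 $\Box_{S_h}R$: from $\{\sigma_r\}_{r\in R},\{\Box_{n_i}\gamma_i\}_{i\in I}\Rightarrow A$ infer $\{\Box_n\sigma_r\}_{r\in R},\{\Box_{n_i}\gamma_i\}_{i\in I}\Rightarrow\Box_nA$; $\Box_hL$: from $\Gamma,A\Rightarrow\Delta$ infer $\Gamma,\Box_nA\Rightarrow\Delta$. $G(\mathbf{K4}_h)$ = axioms + structural + propositional rules + $\Box_{4_h}R$; $G(\mathbf{KD4}_h)$ = $G(\mathbf{K4}_h)$ + $\Box_{D_h}R$; $G(\mathbf{S4}_h)$ = axioms + structural + propositional rules + $\Box_{S_h}R$ + $\Box_hL$. *)

theory Defs
  imports Main "HOL-Library.Multiset"
begin

datatype fm =
    Atom nat
  | Bot
  | Top
  | Neg fm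
  | Conj fm fm
  | Disj fm fm
  | Imp fm fm
  | Box nat fm

fun boxes :: "fm \<Rightarrow> nat set" where
  "boxes (Atom p) = {}"
| "boxes Bot = {}"
| "boxes Top = {}"
| "boxes (Neg A) = boxes A"
| "boxes (Conj A B) = boxes A \<union> boxes B"
| "boxes (Disj A B) = boxes A \<union> boxes B"
| "boxes (Imp A B) = boxes A \<union> boxes B"
| "boxes (Box n A) = insert n (boxes A)"

fun wf :: "fm \<Rightarrow> bool" where
  "wf (Atom p) = True"
| "wf Bot = True"
| "wf Top = True"
| "wf (Neg A) = wf A"
| "wf (Conj A B) = (wf A \<and> wf B)"
| "wf (Disj A B) = (wf A \<and> wf B)"
| "wf (Imp A B) = (wf A \<and> wf B)"
| "wf (Box n A) = (wf A \<and> (\<forall>m\<in>boxes A. m < n))"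

definition wfs :: "fm multiset \<Rightarrow> fm multiset \<Rightarrow> bool" where
  "wfs \<Gamma> \<Delta> = (\<forall>A\<in>#\<Gamma> + \<Delta>. wf A)"

datatype sys = K4h | KD4h | S4h

text \<open>The family \<open>{\<Box>_{n_i} \<gamma>_i}_{i\<in>I}\<close> is given as a multiset of pairs \<open>(n_i, \<gamma>_i)\<close>.\<close>
definition boxfam :: "(nat \<times> fm) multiset \<Rightarrow> fm multiset" where
  "boxfam G = image_mset (\<lambda>(m, g). Box m g) G"

definition bodies :: "(nat \<times> fm) multiset \<Rightarrow> fm multiset" where
  "bodies G = image_mset snd G"

text \<open>\<open>deriv S c \<Gamma> \<Delta>\<close>: the sequent \<open>\<Gamma> \<Rightarrow> \<Delta>\<close> is derivable in system \<open>G(S)\<close>;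
  if \<open>c = False\<close> the cut rule may not be used. Every sequent in a derivation
  consists of formulas of L_infinity (guaranteed by the side condition \<open>wfs\<close>
  on each conclusion and \<open>wf\<close> on the cut formula).\<close>
inductive deriv :: "sys \<Rightarrow> bool \<Rightarrow> fm multiset \<Rightarrow> fm multiset \<Rightarrow> bool" where
  ax: "wf A \<Longrightarrow> deriv S c {#A#} {#A#}"
| botL: "deriv S c {#Bot#} {#}"
| weakL: "deriv S c \<Gamma> \<Delta> \<Longrightarrow> wf A \<Longrightarrow> deriv S c (add_mset A \<Gamma>) \<Delta>"
| weakR: "deriv S c \<Gamma> \<Delta> \<Longrightarrow> wf A \<Longrightarrow> deriv S c \<Gamma> (add_mset A \<Delta>)"
| contrL: "deriv S c (add_mset A (add_mset A \<Gamma>)) \<Delta> \<Longrightarrow> deriv S c (add_mset A \<Gamma>) \<Delta>"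
| contrR: "deriv S c \<Gamma> (add_mset A (add_mset A \<Delta>)) \<Longrightarrow> deriv S c \<Gamma> (add_mset A \<Delta>)"
| cut: "deriv S True \<Gamma>0 (add_mset A \<Delta>0) \<Longrightarrow> deriv S True (add_mset A \<Gamma>1) \<Delta>1 \<Longrightarrow> wf A
        \<Longrightarrow> deriv S True (\<Gamma>0 + \<Gamma>1) (\<Delta>0 + \<Delta>1)"
| conjL1: "deriv S c (add_mset A \<Gamma>) \<Delta> \<Longrightarrow> wf B \<Longrightarrow> deriv S c (add_mset (Conj A B) \<Gamma>) \<Delta>"
| conjL2: "deriv S c (add_mset B \<Gamma>) \<Delta> \<Longrightarrow> wf A \<Longrightarrow> deriv S c (add_mset (Conj A B) \<Gamma>) \<Delta>"
| conjR: "deriv S c \<Gamma> (add_mset A \<Delta>) \<Longrightarrow> deriv S c \<Gamma> (add_mset B \<Delta>)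
        \<Longrightarrow> deriv S c \<Gamma> (add_mset (Conj A B) \<Delta>)"
| disjL: "deriv S c (add_mset A \<Gamma>) \<Delta> \<Longrightarrow> deriv S c (add_mset B \<Gamma>) \<Delta>
        \<Longrightarrow> deriv S c (add_mset (Disj A B) \<Gamma>) \<Delta>"
| disjR1: "deriv S c \<Gamma> (add_mset A \<Delta>) \<Longrightarrow> wf B \<Longrightarrow> deriv S c \<Gamma> (add_mset (Disj A B) \<Delta>)"
| disjR2: "deriv S c \<Gamma> (add_mset B \<Delta>) \<Longrightarrow> wf A \<Longrightarrow> deriv S c \<Gamma> (add_mset (Disj A B) \<Delta>)"
| impL: "deriv S c \<Gamma> (add_mset A \<Delta>) \<Longrightarrow> deriv S c (add_mset B \<Gamma>) \<Delta>
        \<Longrightarrow> deriv S c (add_mset (Imp A B) \<Gamma>) \<Delta>"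
| impR: "deriv S c (add_mset A \<Gamma>) (add_mset B \<Delta>) \<Longrightarrow> deriv S c \<Gamma> (add_mset (Imp A B) \<Delta>)"
| negL: "deriv S c \<Gamma> (add_mset A \<Delta>) \<Longrightarrow> deriv S c (add_mset (Neg A) \<Gamma>) \<Delta>"
| negR: "deriv S c (add_mset A \<Gamma>) \<Delta> \<Longrightarrow> deriv S c \<Gamma> (add_mset (Neg A) \<Delta>)"
| box4R: "S = K4h \<or> S = KD4h \<Longrightarrow> \<forall>(m, g)\<in>#G. m < n
        \<Longrightarrow> wfs (image_mset (Box n) \<Sigma> + boxfam G) {#Box n A#}
        \<Longrightarrow> deriv S c (\<Sigma> + bodies G + boxfam G) {#A#}
        \<Longrightarrow> deriv S c (image_mset (Box n) \<Sigma> + boxfam G) {#Box n A#}"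
| boxDR: "S = KD4h \<Longrightarrow> \<forall>(m, g)\<in>#G. m < n
        \<Longrightarrow> wfs (image_mset (Box n) \<Sigma> + boxfam G) {#}
        \<Longrightarrow> deriv S c (\<Sigma> + bodies G + boxfam G) {#}
        \<Longrightarrow> deriv S c (image_mset (Box n) \<Sigma> + boxfam G) {#}"
| boxSR: "S = S4h \<Longrightarrow> \<forall>(m, g)\<in>#G. m < n
        \<Longrightarrow> wfs (image_mset (Box n) \<Sigma> + boxfam G) {#Box n A#}
        \<Longrightarrow> deriv S c (\<Sigma> + boxfam G) {#A#}
        \<Longrightarrow> deriv S c (image_mset (Box n) \<Sigma> + boxfam G) {#Box n A#}"
| boxL: "S = S4h \<Longrightarrow> deriv S c (add_mset A \<Gamma>) \<Delta> \<Longrightarrow> wf (Box n A)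
        \<Longrightarrow> deriv S c (add_mset (Box n A) \<Gamma>) \<Delta>"

end

theory Submission
  imports Defs
begin

text \<open>Contraction and weakening make derivability depend only on the underlying sets of formulas, so
  cut is eliminated in a calculus on sets whose rules keep their principal formulas. There, a cut
  on a propositional connective reduces to cuts on its arguments by inverting the left rule. For a
  cut on \<open>\<Box>\<^sub>m B\<close> that is principal on the left, one inducts on the right derivation.
  The only delicate case is a modal rule of level \<open>n > m\<close>, whose premise may contain \<open>\<Box>\<^sub>m B\<close>
  and, outside S4, also \<open>B\<close>. Since \<open>m < n\<close>, all formulas from which \<open>\<Box>\<^sub>m B\<close> was derived (and,
  outside S4, their unboxed versions) are still available in that premise, so \<open>\<Box>\<^sub>m B\<close> goes by the
  inner induction and \<open>B\<close> by a smaller cut.\<close>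

section \<open>Set-based calculus and weakening\<close>

text \<open>\<open>jump S n X\<close> is the largest antecedent that the premise of a modal rule of level \<open>n\<close> can have
  when the antecedent of its conclusion is drawn from \<open>X\<close>.\<close>
definition jump :: "sys \<Rightarrow> nat \<Rightarrow> fm set \<Rightarrow> fm set" where
  "jump S n X = {A. Box n A \<in> X} \<union> {Box m A |m A. m < n \<and> Box m A \<in> X}
     \<union> (if S = S4h then {} else {A. \<exists>m<n. Box m A \<in> X})"

definition unboxed :: "fm set \<Rightarrow> fm set" where
  "unboxed X = {A. \<exists>m. Box m A \<in> X}"

text \<open>The rule \<open>boxT\<close> unboxes everything at once, so that \<open>X \<union> unboxed X\<close> contains \<open>jump S4h n X\<close>.\<close>
inductive pr :: "sys \<Rightarrow> fm set \<Rightarrow> fm set \<Rightarrow> bool" for S where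
  ax: "A \<in> X \<Longrightarrow> A \<in> Y \<Longrightarrow> pr S X Y"
| botL: "Bot \<in> X \<Longrightarrow> pr S X Y"
| conjL: "Conj A B \<in> X \<Longrightarrow> pr S (insert A (insert B X)) Y \<Longrightarrow> pr S X Y"
| conjR: "Conj A B \<in> Y \<Longrightarrow> pr S X (insert A Y) \<Longrightarrow> pr S X (insert B Y) \<Longrightarrow> pr S X Y"
| disjL: "Disj A B \<in> X \<Longrightarrow> pr S (insert A X) Y \<Longrightarrow> pr S (insert B X) Y \<Longrightarrow> pr S X Y"
| disjR: "Disj A B \<in> Y \<Longrightarrow> pr S X (insert A (insert B Y)) \<Longrightarrow> pr S X Y"
| impL: "Imp A B \<in> X \<Longrightarrow> pr S X (insert A Y) \<Longrightarrow> pr S (insert B X) Y \<Longrightarrow> pr S X Y"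
| impR: "Imp A B \<in> Y \<Longrightarrow> pr S (insert A X) (insert B Y) \<Longrightarrow> pr S X Y"
| negL: "Neg A \<in> X \<Longrightarrow> pr S X (insert A Y) \<Longrightarrow> pr S X Y"
| negR: "Neg A \<in> Y \<Longrightarrow> pr S (insert A X) Y \<Longrightarrow> pr S X Y"
| boxR: "Box n A \<in> Y \<Longrightarrow> pr S (jump S n X) {A} \<Longrightarrow> pr S X Y"
| boxD: "S = KD4h \<Longrightarrow> pr S (jump S n X) {} \<Longrightarrow> pr S X Y"
| boxT: "S = S4h \<Longrightarrow> pr S (X \<union> unboxed X) Y \<Longrightarrow> pr S X Y"

lemma jump_mono: "X \<subseteq> X' \<Longrightarrow> jump S n X \<subseteq> jump S n X'"
  by (auto simp: jump_def)

lemma unboxed_mono: "X \<subseteq> X' \<Longrightarrow> unboxed X \<subseteq> unboxed X'"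
  by (auto simp: unboxed_def)

text \<open>The rules only ask that their principal formulas be present, and \<open>jump\<close> and
  \<open>unboxed\<close> are monotone, so each rule can be reapplied in the larger sequent.\<close>

lemma pr_mono: "pr S X Y \<Longrightarrow> X \<subseteq> X' \<Longrightarrow> Y \<subseteq> Y' \<Longrightarrow> pr S X' Y'"
proof (induction arbitrary: X' Y' rule: pr.induct)
  case (boxR n A Y X)
  then show ?case by (meson pr.boxR jump_mono order_refl subsetD)
next
  case (boxD n X Y)
  then show ?case by (meson pr.boxD jump_mono order_refl)
next
  case (boxT X Y)
  then show ?case by (meson pr.boxT Un_mono unboxed_mono)
next
  case (conjL A B X Y)
  show ?case by (rule pr.conjL[of A B, OF _ conjL.IH]) (use conjL.hyps conjL.prems in auto)
next
  case (conjR A B Y X)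
  show ?case by (rule pr.conjR[of A B, OF _ conjR.IH]) (use conjR.hyps conjR.prems in auto)
next
  case (disjL A B X Y)
  show ?case by (rule pr.disjL[of A B, OF _ disjL.IH]) (use disjL.hyps disjL.prems in auto)
next
  case (disjR A B Y X)
  show ?case by (rule pr.disjR[of A B, OF _ disjR.IH]) (use disjR.hyps disjR.prems in auto)
next
  case (impL A B X Y)
  show ?case by (rule pr.impL[of A B, OF _ impL.IH]) (use impL.hyps impL.prems in auto)
next
  case (impR A B Y X)
  show ?case by (rule pr.impR[of A B, OF _ impR.IH]) (use impR.hyps impR.prems in auto)
next
  case (negL A X Y)
  show ?case by (rule pr.negL[of A, OF _ negL.IH]) (use negL.hyps negL.prems in auto)
next
  case (negR A Y X)
  show ?case by (rule pr.negR[of A, OF _ negR.IH]) (use negR.hyps negR.prems in auto)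
qed (blast intro: pr.ax pr.botL)+

section \<open>Inversion of the propositional left rules\<close>

text \<open>If \<open>redundantL A X Y\<close>, some premise of the left rule for \<open>A\<close> adds nothing to the sequent, so
  \<open>A\<close> itself may be dropped on the left.\<close>
fun redundantL :: "fm \<Rightarrow> fm set \<Rightarrow> fm set \<Rightarrow> bool" where
  "redundantL (Conj A B) X Y = (A \<in> X \<and> B \<in> X)"
| "redundantL (Disj A B) X Y = (A \<in> X \<or> B \<in> X)"
| "redundantL (Imp A B) X Y = (A \<in> Y \<or> B \<in> X)"
| "redundantL (Neg A) X Y = (A \<in> Y)"
| "redundantL _ X Y = False"

lemma redundantL_mono: "redundantL A X Y \<Longrightarrow> X \<subseteq> X' \<Longrightarrow> Y \<subseteq> Y' \<Longrightarrow> redundantL A X' Y'"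
  by (induction A X Y rule: redundantL.induct) auto

text \<open>The right rule for \<open>A\<close> settles this: redundancy turns each of its premises
  into an axiom.\<close>

lemma redundantL_pr: "redundantL A X Y \<Longrightarrow> A \<in> Y \<Longrightarrow> pr S X Y"
proof (induction A X Y rule: redundantL.induct)
  case (1 A B X Y)
  then show ?case by - (rule pr.conjR[of A B]; auto intro: pr.ax)
next
  case (2 A B X Y)
  then show ?case by - (rule pr.disjR[of A B]; auto intro: pr.ax)
next
  case (3 A B X Y)
  then show ?case by - (rule pr.impR[of A B]; auto intro: pr.ax)
next
  case (4 A X Y)
  then show ?case by - (rule pr.negR[of A]; auto intro: pr.ax)
qed auto

text \<open>A redundant formula is never boxed, and \<open>jump\<close> reads only the boxed
  formulas of its argument.\<close>

lemma redundantL_jump: "redundantL A X Y \<Longrightarrow> X0 \<subseteq> insert A X \<Longrightarrow> jump S n X0 \<subseteq> jump S n X"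
  by (cases A) (auto simp: jump_def)

lemma redundantL_unboxed: "redundantL A X Y \<Longrightarrow> X0 \<subseteq> insert A X \<Longrightarrow> unboxed X0 \<subseteq> unboxed X"
  by (cases A) (auto simp: unboxed_def)

text \<open>If a left rule is principal on \<open>A\<close> and \<open>A\<close> is missing from
  \<open>X\<close>, redundancy makes one of its premises coincide with the goal. An axiom on
  \<open>A\<close> is handled by \<open>redundantL_pr\<close>. The cases \<open>boxR\<close> and
  \<open>boxD\<close> need no induction hypothesis, because dropping \<open>A\<close> leaves enough
  in their premises. The inclusions allow \<open>X\<close> and \<open>Y\<close> to hold the formulas
  gained by inversion.\<close>

lemma pr_drop_redundantL:
  "pr S X0 Y0 \<Longrightarrow> X0 \<subseteq> insert A X \<Longrightarrow> Y0 \<subseteq> Y \<Longrightarrow> redundantL A X Y \<Longrightarrow> pr S X Y"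
proof (induction arbitrary: X Y rule: pr.induct)
  case (ax P X0 Y0)
  then show ?case by (metis insertE pr.ax redundantL_pr subsetD)
next
  case (botL X0 Y0)
  then show ?case by (cases A) (auto intro: pr.botL)
next
  case (conjL P Q X0 Y0)
  have *: "pr S (insert P (insert Q X)) Y"
    using conjL.prems by - (rule conjL.IH; auto intro: redundantL_mono[OF conjL.prems(3)])
  show ?case
  proof (cases "Conj P Q \<in> X")
    case True
    then show ?thesis using * by (rule pr.conjL)
  next
    case False
    then have "insert P (insert Q X) = X" using conjL.hyps conjL.prems by auto
    then show ?thesis using * by simp
  qed
next
  case (conjR P Q Y0 X0)
  show ?case
    by (rule pr.conjR[of P Q, OF _ conjR.IH])
      (use conjR.hyps conjR.prems in \<open>auto intro: redundantL_mono[OF conjR.prems(3)]\<close>)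
next
  case (disjL P Q X0 Y0)
  have *: "pr S (insert P X) Y" "pr S (insert Q X) Y"
    by ((rule disjL.IH(1); use disjL.prems in \<open>auto intro: redundantL_mono[OF disjL.prems(3)]\<close>),
      (rule disjL.IH(2); use disjL.prems in \<open>auto intro: redundantL_mono[OF disjL.prems(3)]\<close>))
  show ?case
  proof (cases "Disj P Q \<in> X")
    case True
    then show ?thesis using * by (rule pr.disjL)
  next
    case False
    then have "insert P X = X \<or> insert Q X = X"
      using disjL.hyps disjL.prems by (auto simp: insert_absorb)
    then show ?thesis using * by auto
  qed
next
  case (disjR P Q Y0 X0)
  show ?case
    by (rule pr.disjR[of P Q, OF _ disjR.IH])
      (use disjR.hyps disjR.prems in \<open>auto intro: redundantL_mono[OF disjR.prems(3)]\<close>)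
next
  case (impL P Q X0 Y0)
  have *: "pr S X (insert P Y)" "pr S (insert Q X) Y"
    by ((rule impL.IH(1); use impL.prems in \<open>auto intro: redundantL_mono[OF impL.prems(3)]\<close>),
      (rule impL.IH(2); use impL.prems in \<open>auto intro: redundantL_mono[OF impL.prems(3)]\<close>))
  show ?case
  proof (cases "Imp P Q \<in> X")
    case True
    then show ?thesis using * by (rule pr.impL)
  next
    case False
    then have "insert P Y = Y \<or> insert Q X = X"
      using impL.hyps impL.prems by (auto simp: insert_absorb)
    then show ?thesis using * by auto
  qed
next
  case (impR P Q Y0 X0)
  show ?case
    by (rule pr.impR[of P Q, OF _ impR.IH])
      (use impR.hyps impR.prems in \<open>auto intro: redundantL_mono[OF impR.prems(3)]\<close>)
next
  case (negL P X0 Y0)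
  have *: "pr S X (insert P Y)"
    using negL.prems by - (rule negL.IH; auto intro: redundantL_mono[OF negL.prems(3)])
  show ?case
  proof (cases "Neg P \<in> X")
    case True
    then show ?thesis using * by (rule pr.negL)
  next
    case False
    then have "insert P Y = Y" using negL.hyps negL.prems by auto
    then show ?thesis using * by auto
  qed
next
  case (negR P Y0 X0)
  show ?case
    by (rule pr.negR[of P, OF _ negR.IH])
      (use negR.hyps negR.prems in \<open>auto intro: redundantL_mono[OF negR.prems(3)]\<close>)
next
  case (boxR n P Y0 X0)
  then show ?case
    by (meson order_refl pr.boxR pr_mono redundantL_jump subsetD)
next
  case (boxD n X0 Y0)
  then show ?case by (meson order_refl pr.boxD pr_mono redundantL_jump)
next
  case (boxT X0 Y0)
  have "pr S (X \<union> unboxed X) Y"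
    using boxT.prems redundantL_unboxed[OF boxT.prems(3,1)]
    by - (rule boxT.IH; auto intro: redundantL_mono[OF boxT.prems(3)])
  then show ?case by (rule pr.boxT[OF boxT.hyps(1)])
qed

section \<open>Cuts on a boxed formula\<close>

lemma jump_insert_Box:
  "X0 \<subseteq> insert (Box m B) X \<Longrightarrow>
    jump S n X0 \<subseteq> (if m < n then insert (Box m B) (insert B (jump S n X))
                  else if m = n then insert B (jump S n X) else jump S n X)"
  by (auto simp: jump_def)

text \<open>What level \<open>m\<close> unboxes as its own boxes, level \<open>n\<close> unboxes as
  lower boxes. In S4 lower boxes are never unboxed by the modal rule, hence the exclusion.\<close>

lemma jump_le: "S \<noteq> S4h \<Longrightarrow> m < n \<Longrightarrow> jump S m X \<subseteq> jump S n X"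
  by (auto simp: jump_def)

text \<open>Boxes of index at most \<open>m\<close> pass intact to level \<open>n\<close>, and
  \<open>jump S m\<close> depends on no others.\<close>

lemma jump_subset_jump_jump: "m < n \<Longrightarrow> jump S m X \<subseteq> jump S m (jump S n X)"
  by (auto simp: jump_def)

lemma jump_S4h_insert_Box:
  "X0 \<subseteq> insert (Box m B) X \<Longrightarrow> m < n \<Longrightarrow> jump S4h n X0 \<subseteq> insert (Box m B) (jump S4h n X)"
  by (auto simp: jump_def)

lemma jump_S4h_subset: "jump S4h m X \<subseteq> X \<union> unboxed X"
  by (auto simp: jump_def unboxed_def)

text \<open>This is the common core of the cases \<open>boxR\<close> and \<open>boxD\<close> of
  \<open>pr_cut_Box\<close>; the assumption \<open>IH\<close> is the induction hypothesis for the
  premise \<open>right\<close>. The set \<open>Y\<close> stands for the succedent of that premise, a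
  singleton or empty.\<close>

lemma pr_cut_Box_jump:
  assumes cut: "\<And>X Y. pr S X (insert B Y) \<Longrightarrow> pr S (insert B X) Y \<Longrightarrow> pr S X Y"
    and X0: "X0 \<subseteq> insert (Box m B) X"
    and left: "pr S (jump S m X) {B}"
    and right: "pr S (jump S n X0) Y"
    and IH: "\<And>X Y'. jump S n X0 \<subseteq> insert (Box m B) X \<Longrightarrow> Y \<subseteq> Y' \<Longrightarrow>
      pr S (jump S m X) {B} \<Longrightarrow> pr S X Y'"
  shows "pr S (jump S n X) Y"
proof (cases m n rule: linorder_cases)
  case less
  show ?thesis
  proof (cases "S = S4h")
    case True
    \<comment> \<open>In S4 only \<open>Box m B\<close> itself reaches the premise, not
      \<open>B\<close>, so no smaller cut arises.\<close>
    show ?thesis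
    proof (rule IH)
      show "jump S n X0 \<subseteq> insert (Box m B) (jump S n X)"
        using jump_S4h_insert_Box[OF X0 less] True by simp
      show "pr S (jump S m (jump S n X)) {B}"
        using left by (rule pr_mono[OF _ jump_subset_jump_jump[OF less]]) simp
    qed simp
  next
    case False
    \<comment> \<open>Here \<open>B\<close> may reach the premise too: \<open>IH\<close> removes
      \<open>Box m B\<close> while \<open>B\<close> stays on the left, and then \<open>B\<close> is
      cut against \<open>left\<close>, lifted to level \<open>n\<close>.\<close>
    show ?thesis
    proof (rule cut)
      show "pr S (jump S n X) (insert B Y)"
        using left by (rule pr_mono[OF _ jump_le[OF False less]]) simp
      show "pr S (insert B (jump S n X)) Y"
      proof (rule IH)
        show "jump S n X0 \<subseteq> insert (Box m B) (insert B (jump S n X))"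
          using jump_insert_Box[OF X0, of S n] less by simp
        have "jump S m X \<subseteq> jump S m (insert B (jump S n X))"
          using jump_subset_jump_jump[OF less] jump_mono[OF subset_insertI] by (rule order_trans)
        then show "pr S (jump S m (insert B (jump S n X))) {B}"
          by (rule pr_mono[OF left]) simp
      qed simp
    qed
  qed
next
  case equal
  show ?thesis
  proof (rule cut)
    show "pr S (jump S n X) (insert B Y)"
      using left by (rule pr_mono) (auto simp: equal)
    show "pr S (insert B (jump S n X)) Y"
      using right by (rule pr_mono) (use jump_insert_Box[OF X0, of S n] equal in auto)
  qed
next
  case greater
  show ?thesis
    using right by (rule pr_mono) (use jump_insert_Box[OF X0, of S n] greater in auto)
qed

text \<open>The left derivation enters through the premise of its final \<open>boxR\<close>. That
  premise is monotone in \<open>X\<close>, so it stays available as the induction on the right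
  derivation enlarges the antecedent.\<close>

lemma pr_cut_Box:
  assumes cut: "\<And>X Y. pr S X (insert B Y) \<Longrightarrow> pr S (insert B X) Y \<Longrightarrow> pr S X Y"
  shows "pr S X0 Y0 \<Longrightarrow> X0 \<subseteq> insert (Box m B) X \<Longrightarrow> Y0 \<subseteq> Y \<Longrightarrow> pr S (jump S m X) {B} \<Longrightarrow> pr S X Y"
proof (induction arbitrary: X Y rule: pr.induct)
  case (ax P X0 Y0)
  \<comment> \<open>For an axiom on the cut formula, \<open>Box m B\<close> is in \<open>Y\<close>,
    and \<open>boxR\<close> applied to the left premise proves the goal.\<close>
  then show ?case by (metis insertE pr.ax pr.boxR subsetD)
next
  case (botL X0 Y0)
  then show ?case by (auto intro: pr.botL)
next
  case (conjL P Q X0 Y0)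
  have *: "pr S (jump S m (insert P (insert Q X))) {B}"
    using conjL.prems(3) by (rule pr_mono) (auto intro!: jump_mono)
  show ?case
    by (rule pr.conjL[of P Q, OF _ conjL.IH])
      (use * conjL.hyps conjL.prems in auto)
next
  case (conjR P Q Y0 X0)
  show ?case by (rule pr.conjR[of P Q, OF _ conjR.IH]) (use conjR.hyps conjR.prems in auto)
next
  case (disjL P Q X0 Y0)
  have *: "pr S (jump S m (insert P X)) {B}" "pr S (jump S m (insert Q X)) {B}"
    by (rule pr_mono[OF disjL.prems(3)]; auto intro!: jump_mono)+
  show ?case
    by (rule pr.disjL[of P Q, OF _ disjL.IH])
      (use * disjL.hyps disjL.prems in auto)
next
  case (disjR P Q Y0 X0)
  show ?case by (rule pr.disjR[of P Q, OF _ disjR.IH]) (use disjR.hyps disjR.prems in auto)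
next
  case (impL P Q X0 Y0)
  have *: "pr S (jump S m (insert Q X)) {B}"
    using impL.prems(3) by (rule pr_mono) (auto intro!: jump_mono)
  show ?case
    by (rule pr.impL[of P Q, OF _ impL.IH])
      (use * impL.hyps impL.prems in auto)
next
  case (impR P Q Y0 X0)
  have *: "pr S (jump S m (insert P X)) {B}"
    using impR.prems(3) by (rule pr_mono) (auto intro!: jump_mono)
  show ?case
    by (rule pr.impR[of P Q, OF _ impR.IH])
      (use * impR.hyps impR.prems in auto)
next
  case (negL P X0 Y0)
  show ?case by (rule pr.negL[of P, OF _ negL.IH]) (use negL.hyps negL.prems in auto)
next
  case (negR P Y0 X0)
  have *: "pr S (jump S m (insert P X)) {B}"
    using negR.prems(3) by (rule pr_mono) (auto intro!: jump_mono)
  show ?case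
    by (rule pr.negR[of P, OF _ negR.IH])
      (use * negR.hyps negR.prems in auto)
next
  case (boxR n P Y0 X0)
  have "pr S (jump S n X) {P}"
    using pr_cut_Box_jump[OF cut boxR.prems(1,3) boxR.hyps(2) boxR.IH] .
  moreover have "Box n P \<in> Y" using boxR.hyps boxR.prems by auto
  ultimately show ?case by (rule pr.boxR[rotated])
next
  case (boxD n X0 Y0)
  have "pr S (jump S n X) {}"
    using pr_cut_Box_jump[OF cut boxD.prems(1,3) boxD.hyps(2) boxD.IH] .
  then show ?case by (rule pr.boxD[OF boxD.hyps(1)])
next
  case (boxT X0 Y0)
  let ?X = "X \<union> unboxed X"
  \<comment> \<open>Unboxing \<open>Box m B\<close> releases \<open>B\<close>, so the induction
    hypothesis is used with \<open>B\<close> added on the left, and a smaller cut removes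
    it.\<close>
  have "pr S (jump S m (insert B ?X)) {B}"
    using boxT.prems(3) by (rule pr_mono) (auto intro!: jump_mono)
  then have "pr S (insert B ?X) Y"
    using boxT.prems by - (rule boxT.IH; auto simp: unboxed_def)
  moreover have "pr S ?X (insert B Y)"
    using boxT.prems(3) by (rule pr_mono) (use boxT.hyps jump_S4h_subset in auto)
  ultimately have "pr S ?X Y" by (rule cut[rotated])
  then show ?case by (rule pr.boxT[OF boxT.hyps(1)])
qed

section \<open>Admissibility of cut\<close>

text \<open>Induction on the derivation with \<open>A\<close> on the right. Since rules keep their
  principal formulas, the induction hypothesis first removes \<open>A\<close> from the premises of a
  propositional rule; if \<open>A\<close> was principal, smaller cuts finish.\<close>

lemma pr_cut_step:
  assumes cut: "\<And>B X Y. size B < size A \<Longrightarrow> pr S X (insert B Y) \<Longrightarrow> pr S (insert B X) Y \<Longrightarrow> pr S X Y"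
  shows "pr S X0 Y0 \<Longrightarrow> X0 \<subseteq> X \<Longrightarrow> Y0 \<subseteq> insert A Y \<Longrightarrow> pr S (insert A X) Y \<Longrightarrow> pr S X Y"
proof (induction arbitrary: X Y rule: pr.induct)
  case (ax P X0 Y0)
  \<comment> \<open>If the axiom formula is \<open>A\<close>, then \<open>A\<close> is in
    \<open>X\<close>, and the right derivation already proves the goal.\<close>
  then show ?case by (metis insertE insert_absorb pr.ax subsetD)
next
  case (botL X0 Y0)
  then show ?case by (auto intro: pr.botL)
next
  case (conjL P Q X0 Y0)
  have *: "pr S (insert A (insert P (insert Q X))) Y"
    using conjL.prems(3) by (rule pr_mono) auto
  show ?case
    by (rule pr.conjL[of P Q, OF _ conjL.IH])
      (use * conjL.hyps conjL.prems in auto)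
next
  case (conjR P Q Y0 X0)
  have "pr S (insert A X) (insert P Y)" "pr S (insert A X) (insert Q Y)"
    by (rule pr_mono[OF conjR.prems(3)]; blast)+
  then have *: "pr S X (insert P Y)" "pr S X (insert Q Y)"
    by - ((rule conjR.IH(1); use conjR.prems in auto),
      (rule conjR.IH(2); use conjR.prems in auto))
  show ?case
  proof (cases "Conj P Q \<in> Y")
    case True
    then show ?thesis using * by (rule pr.conjR)
  next
    case False
    then have A: "A = Conj P Q" using conjR.hyps conjR.prems by auto
    \<comment> \<open>Inversion of the right derivation: with \<open>P\<close> and \<open>Q\<close>
      on the left, \<open>A\<close> is redundant.\<close>
    have "pr S (insert P (insert Q X)) Y"
      using conjR.prems(3) by (rule pr_drop_redundantL[of _ _ _ A]) (auto simp: A)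
    moreover have "pr S (insert Q X) (insert P Y)"
      using *(1) by (rule pr_mono) auto
    ultimately have "pr S (insert Q X) Y"
      using cut[of P] by (simp add: A)
    then show ?thesis
      using cut[of Q] *(2) by (simp add: A)
  qed
next
  case (disjL P Q X0 Y0)
  have *: "pr S (insert A (insert P X)) Y" "pr S (insert A (insert Q X)) Y"
    by (rule pr_mono[OF disjL.prems(3)]; blast)+
  show ?case
    by (rule pr.disjL[of P Q, OF _ disjL.IH])
      (use * disjL.hyps disjL.prems in auto)
next
  case (disjR P Q Y0 X0)
  have "pr S (insert A X) (insert P (insert Q Y))"
    using disjR.prems(3) by (rule pr_mono) auto
  then have *: "pr S X (insert P (insert Q Y))"
    using disjR.prems by - (rule disjR.IH; auto)
  show ?case
  proof (cases "Disj P Q \<in> Y")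
    case True
    then show ?thesis using * by (rule pr.disjR)
  next
    case False
    then have A: "A = Disj P Q" using disjR.hyps disjR.prems by auto
    have R: "pr S (insert P X) Y" "pr S (insert Q X) Y"
      by (rule pr_drop_redundantL[of _ _ _ A, OF disjR.prems(3)]; auto simp: A)+
    have "pr S (insert P X) (insert Q Y)"
      using R(1) by (rule pr_mono) auto
    then have "pr S X (insert Q Y)"
      using cut[of P] * by (simp add: A)
    then show ?thesis
      using cut[of Q] R(2) by (simp add: A)
  qed
next
  case (impL P Q X0 Y0)
  have *: "pr S (insert A X) (insert P Y)" "pr S (insert A (insert Q X)) Y"
    by (rule pr_mono[OF impL.prems(3)]; blast)+
  show ?case
    by (rule pr.impL[of P Q, OF _ impL.IH])
      (use * impL.hyps impL.prems in auto)
next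
  case (impR P Q Y0 X0)
  have "pr S (insert A (insert P X)) (insert Q Y)"
    using impR.prems(3) by (rule pr_mono) auto
  then have *: "pr S (insert P X) (insert Q Y)"
    using impR.prems by - (rule impR.IH; auto)
  show ?case
  proof (cases "Imp P Q \<in> Y")
    case True
    then show ?thesis using * by (rule pr.impR)
  next
    case False
    then have A: "A = Imp P Q" using impR.hyps impR.prems by auto
    have R: "pr S X (insert P Y)" "pr S (insert Q X) Y"
      by (rule pr_drop_redundantL[of _ _ _ A, OF impR.prems(3)]; auto simp: A)+
    have "pr S X (insert P (insert Q Y))"
      using R(1) by (rule pr_mono) auto
    then have "pr S X (insert Q Y)"
      using cut[of P] * by (simp add: A)
    then show ?thesis
      using cut[of Q] R(2) by (simp add: A)
  qed
next
  case (negL P X0 Y0)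
  have *: "pr S (insert A X) (insert P Y)"
    using negL.prems(3) by (rule pr_mono) auto
  show ?case
    by (rule pr.negL[of P, OF _ negL.IH])
      (use * negL.hyps negL.prems in auto)
next
  case (negR P Y0 X0)
  have "pr S (insert A (insert P X)) Y"
    using negR.prems(3) by (rule pr_mono) auto
  then have *: "pr S (insert P X) Y"
    using negR.prems by - (rule negR.IH; auto)
  show ?case
  proof (cases "Neg P \<in> Y")
    case True
    then show ?thesis using * by (rule pr.negR)
  next
    case False
    then have A: "A = Neg P" using negR.hyps negR.prems by auto
    have "pr S X (insert P Y)"
      using negR.prems(3) by (rule pr_drop_redundantL[of _ _ _ A]) (auto simp: A)
    then show ?thesis
      using cut[of P] * by (simp add: A)
  qed
next
  case (boxR n P Y0 X0)
  \<comment> \<open>The succedent of a modal premise keeps no side formulas, so \<open>A\<close>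
    need not be removed from it and weakening is enough.\<close>
  have *: "pr S (jump S n X) {P}"
    using boxR.hyps(2) by (rule pr_mono) (auto intro!: jump_mono boxR.prems)
  show ?case
  proof (cases "Box n P \<in> Y")
    case True
    then show ?thesis using * by (rule pr.boxR)
  next
    case False
    then have A: "A = Box n P" using boxR.hyps boxR.prems by auto
    have cut': "pr S X Y" if "pr S X (insert P Y)" "pr S (insert P X) Y" for X Y
      using cut[of P] that by (simp add: A)
    show ?thesis
      by (rule pr_cut_Box[OF cut' boxR.prems(3)]) (use * A in auto)
  qed
next
  case (boxD n X0 Y0)
  have "pr S (jump S n X) {}"
    using boxD.hyps(2) by (rule pr_mono) (auto intro!: jump_mono boxD.prems)
  then show ?case by (rule pr.boxD[OF boxD.hyps(1)])
next
  case (boxT X0 Y0)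
  have "pr S (insert A (X \<union> unboxed X)) Y"
    using boxT.prems(3) by (rule pr_mono) auto
  then have "pr S (X \<union> unboxed X) Y"
    using boxT.prems unboxed_mono[OF boxT.prems(1)] by - (rule boxT.IH; auto)
  then show ?case by (rule pr.boxT[OF boxT.hyps(1)])
qed

lemma pr_cut: "pr S X (insert A Y) \<Longrightarrow> pr S (insert A X) Y \<Longrightarrow> pr S X Y"
proof (induction A arbitrary: X Y rule: measure_induct_rule[of size])
  case (less A)
  show ?case
    by (rule pr_cut_step[OF less.IH less.prems(1) _ _ less.prems(2)]) auto
qed

section \<open>From multiset derivations with cut to the set calculus\<close>

lemma jump_supset:
  assumes "\<forall>(m, g)\<in>#G. m < n"
  shows "set_mset \<Sigma> \<union> set_mset (boxfam G) \<union> (if S = S4h then {} else set_mset (bodies G))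
    \<subseteq> jump S n (set_mset (image_mset (Box n) \<Sigma> + boxfam G))"
proof -
  define J where "J = jump S n (set_mset (image_mset (Box n) \<Sigma> + boxfam G))"
  have "Box m B \<in> J \<and> (S \<noteq> S4h \<longrightarrow> B \<in> J)" if "(m, B) \<in># G" for m B
  proof -
    have "m < n" using assms that by auto
    moreover have "Box m B \<in># boxfam G" using that by (force simp: boxfam_def)
    ultimately show ?thesis by (auto simp: J_def jump_def)
  qed
  then have "set_mset (boxfam G) \<subseteq> J" "S \<noteq> S4h \<Longrightarrow> set_mset (bodies G) \<subseteq> J"
    by (auto simp: boxfam_def bodies_def)
  moreover have "set_mset \<Sigma> \<subseteq> J"
    by (auto simp: J_def jump_def)
  ultimately show ?thesis unfolding J_def[symmetric] by simp
qed

text \<open>Cut disappears here through \<open>pr_cut\<close>. Contraction does not change the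
  underlying sets, and weakening is \<open>pr_mono\<close>.\<close>

lemma deriv_imp_pr: "deriv S c \<Gamma> \<Delta> \<Longrightarrow> pr S (set_mset \<Gamma>) (set_mset \<Delta>)"
proof (induction rule: deriv.induct)
  case (cut S \<Gamma>0 A \<Delta>0 \<Gamma>1 \<Delta>1)
  show ?case
  proof (rule pr_cut)
    show "pr S (set_mset (\<Gamma>0 + \<Gamma>1)) (insert A (set_mset (\<Delta>0 + \<Delta>1)))"
      using cut.IH(1) by (rule pr_mono) auto
    show "pr S (insert A (set_mset (\<Gamma>0 + \<Gamma>1))) (set_mset (\<Delta>0 + \<Delta>1))"
      using cut.IH(2) by (rule pr_mono) auto
  qed
next
  case (ax A S c)
  show ?case by (rule pr.ax[of A]) auto
next
  case (botL S c)
  show ?case by (rule pr.botL) auto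
next
  case (weakL S c \<Gamma> \<Delta> A)
  show ?case by (rule pr_mono[OF weakL.IH]) auto
next
  case (weakR S c \<Gamma> \<Delta> A)
  show ?case by (rule pr_mono[OF weakR.IH]) auto
next
  case (conjL1 S c A \<Gamma> \<Delta> B)
  show ?case by (rule pr.conjL[of A B]) (auto intro: pr_mono[OF conjL1.IH])
next
  case (conjL2 S c B \<Gamma> \<Delta> A)
  show ?case by (rule pr.conjL[of A B]) (auto intro: pr_mono[OF conjL2.IH])
next
  case (conjR S c \<Gamma> A \<Delta> B)
  show ?case by (rule pr.conjR[of A B]) (auto intro: conjR.IH[THEN pr_mono])
next
  case (disjL S c A \<Gamma> \<Delta> B)
  show ?case by (rule pr.disjL[of A B]) (auto intro: disjL.IH[THEN pr_mono])
next
  case (disjR1 S c \<Gamma> A \<Delta> B)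
  show ?case by (rule pr.disjR[of A B]) (auto intro: disjR1.IH[THEN pr_mono])
next
  case (disjR2 S c \<Gamma> B \<Delta> A)
  show ?case by (rule pr.disjR[of A B]) (auto intro: disjR2.IH[THEN pr_mono])
next
  case (impL S c \<Gamma> A \<Delta> B)
  show ?case by (rule pr.impL[of A B]) (auto intro: impL.IH[THEN pr_mono])
next
  case (impR S c A \<Gamma> B \<Delta>)
  show ?case by (rule pr.impR[of A B]) (auto intro: impR.IH[THEN pr_mono])
next
  case (negL S c \<Gamma> A \<Delta>)
  show ?case by (rule pr.negL[of A]) (auto intro: negL.IH[THEN pr_mono])
next
  case (negR S c A \<Gamma> \<Delta>)
  show ?case by (rule pr.negR[of A]) (auto intro: negR.IH[THEN pr_mono])
next
  case (box4R S G n \<Sigma> A c)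
  show ?case
  proof (rule pr.boxR)
    show "pr S (jump S n (set_mset (image_mset (Box n) \<Sigma> + boxfam G))) {A}"
      using box4R.IH
        by (rule pr_mono) (use jump_supset[OF box4R.hyps(2), of \<Sigma> S] box4R.hyps(1) in auto)
  qed simp
next
  case (boxDR S G n \<Sigma> c)
  have "pr S (jump S n (set_mset (image_mset (Box n) \<Sigma> + boxfam G))) {}"
    using boxDR.IH
      by (rule pr_mono) (use jump_supset[OF boxDR.hyps(2), of \<Sigma> S] boxDR.hyps(1) in auto)
  then show ?case using pr.boxD[OF boxDR.hyps(1)] by simp
next
  case (boxSR S G n \<Sigma> A c)
  show ?case
  proof (rule pr.boxR)
    show "pr S (jump S n (set_mset (image_mset (Box n) \<Sigma> + boxfam G))) {A}"
      using boxSR.IH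
        by (rule pr_mono) (use jump_supset[OF boxSR.hyps(2), of \<Sigma> S] boxSR.hyps(1) in auto)
  qed simp
next
  case (boxL S c A \<Gamma> \<Delta> n)
  show ?case
    using boxL.IH by (rule pr.boxT[OF boxL.hyps(1) pr_mono]) (auto simp: unboxed_def)
qed auto

section \<open>Back to cut-free multiset derivations\<close>

text \<open>The set calculus does not track well-formedness, so it is secured separately for the
  return translation.\<close>

lemma deriv_wfs: "deriv S c \<Gamma> \<Delta> \<Longrightarrow> wfs \<Gamma> \<Delta>"
  by (induction rule: deriv.induct) (auto simp: wfs_def)

lemma wfsD: "wfs \<Gamma> \<Delta> \<Longrightarrow> A \<in># \<Gamma> \<or> A \<in># \<Delta> \<Longrightarrow> wf A"
  by (auto simp: wfs_def)

lemma wfsI: "\<forall>A\<in>X. wf A \<Longrightarrow> set_mset \<Gamma> \<subseteq> X \<Longrightarrow> \<forall>A\<in>#\<Delta>. wf A \<Longrightarrow> wfs \<Gamma> \<Delta>"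
  by (auto simp: wfs_def)

lemma deriv_weaken:
  "deriv S c \<Gamma> \<Delta> \<Longrightarrow> wfs \<Gamma>' \<Delta>' \<Longrightarrow> deriv S c (\<Gamma>' + \<Gamma>) (\<Delta>' + \<Delta>)"
proof (induction \<Gamma>')
  case empty
  then show ?case
    by (induction \<Delta>') (auto simp: wfs_def intro: deriv.weakR)
qed (auto simp: wfs_def intro: deriv.weakL)

lemma deriv_contractL:
  "deriv S c (\<Gamma> + \<Gamma>') \<Delta> \<Longrightarrow> set_mset \<Gamma> \<subseteq> set_mset \<Gamma>' \<Longrightarrow> deriv S c \<Gamma>' \<Delta>"
proof (induction \<Gamma>)
  case (add A \<Gamma>)
  then obtain \<Gamma>'' where "\<Gamma>' = add_mset A \<Gamma>''" by (auto dest: multi_member_split)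
  then show ?case using add deriv.contrL[of S c A "\<Gamma> + \<Gamma>''" \<Delta>] by auto
qed simp

lemma deriv_contractR:
  "deriv S c \<Gamma> (\<Delta> + \<Delta>') \<Longrightarrow> set_mset \<Delta> \<subseteq> set_mset \<Delta>' \<Longrightarrow> deriv S c \<Gamma> \<Delta>'"
proof (induction \<Delta>)
  case (add A \<Delta>)
  then obtain \<Delta>'' where "\<Delta>' = add_mset A \<Delta>''" by (auto dest: multi_member_split)
  then show ?case using add deriv.contrR[of S c \<Gamma> A "\<Delta> + \<Delta>''"] by auto
qed simp

text \<open>Weakening adds the whole target sequent; contraction then absorbs the original one into
  it.\<close>

lemma deriv_set_mono:
  assumes "deriv S c \<Gamma> \<Delta>" "set_mset \<Gamma> \<subseteq> set_mset \<Gamma>'" "set_mset \<Delta> \<subseteq> set_mset \<Delta>'" "wfs \<Gamma>' \<Delta>'"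
  shows "deriv S c \<Gamma>' \<Delta>'"
proof -
  have "deriv S c (\<Gamma> + \<Gamma>') (\<Delta> + \<Delta>')"
    using deriv_weaken[OF assms(1,4)] by (simp add: add.commute)
  then show ?thesis
    using assms(2,3) by (blast intro: deriv_contractL deriv_contractR)
qed

text \<open>This simulates \<open>boxT\<close>: each unboxed formula is boxed again by
  \<open>boxL\<close> and contracted into the copy present in \<open>\<Gamma>\<close>.\<close>

lemma deriv_S4h_unboxed:
  "deriv S4h c (\<Gamma>' + \<Gamma>) \<Delta> \<Longrightarrow> wfs \<Gamma> \<Delta> \<Longrightarrow> set_mset \<Gamma>' \<subseteq> unboxed (set_mset \<Gamma>) \<Longrightarrow> deriv S4h c \<Gamma> \<Delta>"
proof (induction \<Gamma>')
  case (add A \<Gamma>')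
  then obtain n where n: "Box n A \<in># \<Gamma>" by (auto simp: unboxed_def)
  then have "wf (Box n A)" using add.prems(2) wfsD by blast
  then have "deriv S4h c (add_mset (Box n A) (\<Gamma>' + \<Gamma>)) \<Delta>"
    using add.prems by (intro deriv.boxL) auto
  then have "deriv S4h c (\<Gamma>' + \<Gamma>) \<Delta>"
    using n deriv_contractL[of S4h c "{#Box n A#}" "\<Gamma>' + \<Gamma>" \<Delta>] by simp
  then show ?case using add by simp
qed simp

lemma finite_unboxed: "finite X \<Longrightarrow> finite (unboxed X)"
  \<comment> \<open>The value of the case expression on unboxed formulas is irrelevant, as only an
    inclusion is needed.\<close>
  by (rule finite_subset[of _ "(\<lambda>B. case B of Box n A \<Rightarrow> A) ` X"])
    (force simp: unboxed_def image_iff)+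

lemma wf_jump: "\<forall>A\<in>X. wf A \<Longrightarrow> \<forall>A\<in>jump S n X. wf A"
  by (fastforce simp: jump_def split: if_splits)

lemma wf_unboxed: "\<forall>A\<in>X. wf A \<Longrightarrow> \<forall>A\<in>unboxed X. wf A"
  by (fastforce simp: unboxed_def)

text \<open>This exhibits \<open>jump S n X\<close> as exactly the antecedent of a premise of a
  multiset modal rule. Finiteness matters because \<open>mset_set\<close> of an infinite set is
  empty.\<close>

lemma jump_msets:
  assumes "finite X"
  obtains \<Sigma> G where "set_mset (image_mset (Box n) \<Sigma> + boxfam G) \<subseteq> X"
    and "\<forall>(m, g)\<in>#G. m < n"
    and "jump S n X = set_mset (\<Sigma> + (if S = S4h then {#} else bodies G) + boxfam G)"
proof
  let ?\<Sigma> = "mset_set {A. Box n A \<in> X}"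
  let ?G = "mset_set {(m, A). m < n \<and> Box m A \<in> X}"
  have "finite {A. Box n A \<in> X}"
    by (rule finite_subset[OF _ finite_unboxed[OF assms]]) (auto simp: unboxed_def)
  moreover have "finite {(m, A). m < n \<and> Box m A \<in> X}"
    by (rule finite_subset[OF _ finite_cartesian_product[OF finite_lessThan finite_unboxed[OF assms]]])
      (auto simp: unboxed_def)
  ultimately show "set_mset (image_mset (Box n) ?\<Sigma> + boxfam ?G) \<subseteq> X"
    and "\<forall>(m, g)\<in>#?G. m < n"
    and "jump S n X = set_mset (?\<Sigma> + (if S = S4h then {#} else bodies ?G) + boxfam ?G)"
    by (force simp: boxfam_def bodies_def jump_def)+
qed

text \<open>Each multiset rule adds a fresh copy of a principal formula that the set calculus has
  kept; \<open>deriv_set_mono\<close> merges the copies.\<close>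

lemma pr_imp_deriv:
  "pr S X Y \<Longrightarrow> X = set_mset \<Gamma> \<Longrightarrow> Y = set_mset \<Delta> \<Longrightarrow> wfs \<Gamma> \<Delta> \<Longrightarrow> deriv S False \<Gamma> \<Delta>"
proof (induction arbitrary: \<Gamma> \<Delta> rule: pr.induct)
  case (ax A X Y)
  then have "deriv S False {#A#} {#A#}" by (intro deriv.ax) (auto simp: wfs_def)
  then show ?case using ax by (elim deriv_set_mono) auto
next
  case (botL X Y)
  then show ?case using deriv_set_mono[OF deriv.botL] by auto
next
  case (conjL A B X Y)
  have wf: "wf A" "wf B"
    using wfsD[OF conjL.prems(3), of "Conj A B"] conjL.hyps(1) conjL.prems by auto
  have "deriv S False (add_mset A (add_mset B \<Gamma>)) \<Delta>"
    using conjL wf by - (rule conjL.IH; auto simp: wfs_def)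
  \<comment> \<open>The set rule adds both conjuncts, while \<open>conjL1\<close> and
    \<open>conjL2\<close> treat one each, so both are applied.\<close>
  then have "deriv S False (add_mset B (add_mset (Conj A B) \<Gamma>)) \<Delta>"
    using deriv.conjL1[of S False A "add_mset B \<Gamma>" \<Delta> B] wf by (simp add: add_mset_commute)
  then have "deriv S False (add_mset (Conj A B) (add_mset (Conj A B) \<Gamma>)) \<Delta>"
    using deriv.conjL2[of S False B "add_mset (Conj A B) \<Gamma>" \<Delta> A] wf by simp
  then show ?case using conjL by (elim deriv_set_mono) auto
next
  case (conjR A B Y X)
  have wf: "wf A" "wf B"
    using wfsD[OF conjR.prems(3), of "Conj A B"] conjR.hyps(1) conjR.prems by auto
  have "deriv S False \<Gamma> (add_mset A \<Delta>)" "deriv S False \<Gamma> (add_mset B \<Delta>)"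
    by ((rule conjR.IH(1); use conjR.prems wf in \<open>auto simp: wfs_def\<close>),
      (rule conjR.IH(2); use conjR.prems wf in \<open>auto simp: wfs_def\<close>))
  then have "deriv S False \<Gamma> (add_mset (Conj A B) \<Delta>)" by (rule deriv.conjR)
  then show ?case using conjR by (elim deriv_set_mono) auto
next
  case (disjL A B X Y)
  have wf: "wf A" "wf B"
    using wfsD[OF disjL.prems(3), of "Disj A B"] disjL.hyps(1) disjL.prems by auto
  have "deriv S False (add_mset A \<Gamma>) \<Delta>" "deriv S False (add_mset B \<Gamma>) \<Delta>"
    by ((rule disjL.IH(1); use disjL.prems wf in \<open>auto simp: wfs_def\<close>),
      (rule disjL.IH(2); use disjL.prems wf in \<open>auto simp: wfs_def\<close>))
  then have "deriv S False (add_mset (Disj A B) \<Gamma>) \<Delta>" by (rule deriv.disjL)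
  then show ?case using disjL by (elim deriv_set_mono) auto
next
  case (disjR A B Y X)
  have wf: "wf A" "wf B"
    using wfsD[OF disjR.prems(3), of "Disj A B"] disjR.hyps(1) disjR.prems by auto
  have "deriv S False \<Gamma> (add_mset A (add_mset B \<Delta>))"
    using disjR wf by - (rule disjR.IH; auto simp: wfs_def)
  then have "deriv S False \<Gamma> (add_mset B (add_mset (Disj A B) \<Delta>))"
    using deriv.disjR1[of S False \<Gamma> A "add_mset B \<Delta>" B] wf by (simp add: add_mset_commute)
  then have "deriv S False \<Gamma> (add_mset (Disj A B) (add_mset (Disj A B) \<Delta>))"
    using deriv.disjR2[of S False \<Gamma> B "add_mset (Disj A B) \<Delta>" A] wf by simp
  then show ?case using disjR by (elim deriv_set_mono) auto
next
  case (impL A B X Y)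
  have wf: "wf A" "wf B"
    using wfsD[OF impL.prems(3), of "Imp A B"] impL.hyps(1) impL.prems by auto
  have "deriv S False \<Gamma> (add_mset A \<Delta>)" "deriv S False (add_mset B \<Gamma>) \<Delta>"
    by ((rule impL.IH(1); use impL.prems wf in \<open>auto simp: wfs_def\<close>),
      (rule impL.IH(2); use impL.prems wf in \<open>auto simp: wfs_def\<close>))
  then have "deriv S False (add_mset (Imp A B) \<Gamma>) \<Delta>" by (rule deriv.impL)
  then show ?case using impL by (elim deriv_set_mono) auto
next
  case (impR A B Y X)
  have wf: "wf A" "wf B"
    using wfsD[OF impR.prems(3), of "Imp A B"] impR.hyps(1) impR.prems by auto
  have "deriv S False (add_mset A \<Gamma>) (add_mset B \<Delta>)"
    using impR wf by - (rule impR.IH; auto simp: wfs_def)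
  then have "deriv S False \<Gamma> (add_mset (Imp A B) \<Delta>)" by (rule deriv.impR)
  then show ?case using impR by (elim deriv_set_mono) auto
next
  case (negL A X Y)
  have wf: "wf A"
    using wfsD[OF negL.prems(3), of "Neg A"] negL.hyps(1) negL.prems by auto
  have "deriv S False \<Gamma> (add_mset A \<Delta>)"
    using negL wf by - (rule negL.IH; auto simp: wfs_def)
  then have "deriv S False (add_mset (Neg A) \<Gamma>) \<Delta>" by (rule deriv.negL)
  then show ?case using negL by (elim deriv_set_mono) auto
next
  case (negR A Y X)
  have wf: "wf A"
    using wfsD[OF negR.prems(3), of "Neg A"] negR.hyps(1) negR.prems by auto
  have "deriv S False (add_mset A \<Gamma>) \<Delta>"
    using negR wf by - (rule negR.IH; auto simp: wfs_def)
  then have "deriv S False \<Gamma> (add_mset (Neg A) \<Delta>)" by (rule deriv.negR)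
  then show ?case using negR by (elim deriv_set_mono) auto
next
  case (boxR n A Y X)
  obtain \<Sigma> G where sub: "set_mset (image_mset (Box n) \<Sigma> + boxfam G) \<subseteq> X"
    and less: "\<forall>(m, g)\<in>#G. m < n"
    and jump: "jump S n X = set_mset (\<Sigma> + (if S = S4h then {#} else bodies G) + boxfam G)"
    using jump_msets[of X] boxR.prems(1) by (metis finite_set_mset)
  have wf: "\<forall>B\<in>X. wf B" "wf (Box n A)"
    using wfsD[OF boxR.prems(3)] boxR.hyps(1) boxR.prems(1,2) by blast+
  have "deriv S False (\<Sigma> + (if S = S4h then {#} else bodies G) + boxfam G) {#A#}"
    using wf by (intro boxR.IH[OF jump] wfsI[OF wf_jump[OF wf(1)] equalityD2[OF jump]]) simp_all
  moreover have "wfs (image_mset (Box n) \<Sigma> + boxfam G) {#Box n A#}"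
    using wf(2) by (intro wfsI[OF wf(1) sub]) simp
  \<comment> \<open>The bodies are absent exactly for \<open>S4h\<close>, matching the premise of
    \<open>boxSR\<close> there and of \<open>box4R\<close> otherwise.\<close>
  ultimately have "deriv S False (image_mset (Box n) \<Sigma> + boxfam G) {#Box n A#}"
    using less deriv.box4R[of S G n \<Sigma> A False] deriv.boxSR[of S G n \<Sigma> A False]
    by - (cases S, simp_all)
  then show ?case
    by (rule deriv_set_mono) (use boxR.hyps(1) boxR.prems sub in simp_all)
next
  case (boxD n X Y)
  obtain \<Sigma> G where sub: "set_mset (image_mset (Box n) \<Sigma> + boxfam G) \<subseteq> X"
    and less: "\<forall>(m, g)\<in>#G. m < n"
    and jump: "jump S n X = set_mset (\<Sigma> + (if S = S4h then {#} else bodies G) + boxfam G)"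
    using jump_msets[of X] boxD.prems(1) by (metis finite_set_mset)
  have wf: "\<forall>B\<in>X. wf B"
    using boxD.prems by (auto simp: wfs_def)
  have "deriv S False (\<Sigma> + (if S = S4h then {#} else bodies G) + boxfam G) {#}"
    by (intro boxD.IH[OF jump] wfsI[OF wf_jump[OF wf] equalityD2[OF jump]]) simp_all
  moreover have "wfs (image_mset (Box n) \<Sigma> + boxfam G) {#}"
    by (intro wfsI[OF wf sub]) simp
  ultimately have "deriv S False (image_mset (Box n) \<Sigma> + boxfam G) {#}"
    using less boxD.hyps(1) deriv.boxDR[of S G n \<Sigma> False] by simp
  then show ?case
    by (rule deriv_set_mono) (use boxD.prems sub in simp_all)
next
  case (boxT X Y)
  let ?U = "mset_set (unboxed X)"
  have U: "set_mset ?U = unboxed X"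
    using boxT.prems by (simp add: finite_unboxed)
  have wf: "\<forall>A\<in>X. wf A" "\<forall>A\<in>#\<Delta>. wf A"
    using wfsD[OF boxT.prems(3)] boxT.prems(1) by blast+
  have "deriv S False (?U + \<Gamma>) \<Delta>"
  proof (rule boxT.IH)
    show "X \<union> unboxed X = set_mset (?U + \<Gamma>)"
      using U boxT.prems by auto
    show "wfs (?U + \<Gamma>) \<Delta>"
      using wf wf_unboxed[OF wf(1)] U boxT.prems(1) by (intro wfsI[of "X \<union> unboxed X"]) auto
  qed (use boxT.prems in simp)
  then show ?case
    using deriv_S4h_unboxed[of False ?U] U boxT.hyps boxT.prems by auto
qed

theorem theorem3p8:
  fixes S :: sys and \<Gamma> \<Delta> :: "fm multiset"
  assumes "deriv S True \<Gamma> \<Delta>"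
  shows "deriv S False \<Gamma> \<Delta>"
  using pr_imp_deriv[OF deriv_imp_pr[OF assms] refl refl deriv_wfs[OF assms]] .

end
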